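(* Let $(X,\rho)$ be an Hadamard space, $A\colon X\to 2^{TX}$ a monotone vector field satisfying the surjectivity condition, $J_\lambda$ the resolvent of $A$ with respect to $\lambda>0$, $v$ an element in $X$, and $\{x_n\}$ a sequence defined by $x_1\in X$ and $$x_{n+1}=\alpha_nv\oplus(1-\alpha_n)J_{\lambda_n}x_n\quad(n=1,2,\dots),$$ where $\{\alpha_n\}$ is a sequence in $[0,1]$ and $\{\lambda_n\}$ is a sequence of positive real numbers such that $\lim_n\lambda_n=\infty$. Then the following hold. (i) $\{J_{\lambda_n}x_n\}$ is bounded if and only if $\mathcal{Z}(A)$ is nonempty. (ii) If $\mathcal{Z}(A)$ is nonempty, $\lim_n\alpha_n=0$, and $\sum_{n=1}^{\infty}\alpha_n=\infty$, then $\{x_n\}$ and $\{J_{\lambda_n}x_n\}$ are convergent (in the metric $\rho$) to $Pv$, where $P$ denotes the metric projection of $X$ onto $\mathcal{Z}(A)$.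
   Context: Geodesics and CAT(0) spaces. In a metric space $(X,\rho)$, a geodesic from $p$ to $q$ is a map $\gamma\colon[0,\rho(p,q)]\to X$ with $\gamma(0)=p$, $\gamma(\rho(p,q))=q$ and $\rho(\gamma(s),\gamma(t))=|s-t|$ for all $s,t$. $X$ is uniquely geodesic if for all $p,q\in X$ there is exactly one geodesic from $p$ to $q$, denoted $\gamma_{p,q}$; then $(1-\alpha)p\oplus\alpha q:=\gamma_{p,q}(\alpha\rho(p,q))$ for $\alpha\in[0,1]$. $X$ is a CAT(0) space if it is uniquely geodesic and $\rho((1-\alpha)x\oplus\alpha y,(1-\beta)x\oplus\beta z)\le|(1-\alpha)\bar x+\alpha\bar y-((1-\beta)\bar x+\beta\bar z)|$ whenever $\alpha,\beta\in[0,1]$, $x,y,z\in X$ and $\bar x,\bar y,\bar z\in\mathbb{R}^2$ satisfy $\rho(x,y)=|\bar x-\bar y|$, $\rho(y,z)=|\bar y-\bar z|$, $\rho(z,x)=|\bar z-\bar x|$. An Hadamard space is a complete CAT(0) space. Tangent spaces. Let $X$ be CAT(0) and $p\in X$; $\Gamma_p$ is the set of all geodesics from $p$ (i.e. all $\gamma_{p,x}$, $x\in X$). For $x,y\ne p$ the comparison angle is $\overline{\angle}_p(x,y)=\arccos\frac{\rho(p,x)^2+\rho(p,y)^2-\rho(x,y)^2}{2\rho(p,x)\rho(p,y)}$. The Alexandrov angle is $\angle_p(\gamma_{p,x},\gamma_{p,y})=\lim_{s,t\to+0}\overline{\angle}_p(\gamma_{p,x}(s),\gamma_{p,y}(t))$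 if $x\ne p$ and $y\ne p$; it is $\pi/2$ if exactly one of $x,y$ equals $p$, and $0$ if $x=y=p$. On $[0,\infty)\times\Gamma_p$ define $\tilde d_p((\alpha,\gamma_{p,x}),(\beta,\gamma_{p,y}))=\sqrt{(\alpha\rho(p,x))^2+(\beta\rho(p,y))^2-2\alpha\rho(p,x)\beta\rho(p,y)\cos\angle_p(\gamma_{p,x},\gamma_{p,y})}$, which is a pseudometric. The tangent space $T_pX$ is the quotient metric space of $[0,\infty)\times\Gamma_p$ under $(\alpha,\gamma)\sim(\beta,\eta)\iff\tilde d_p((\alpha,\gamma),(\beta,\eta))=0$, with induced metric $d_p$; the class of $(\alpha,\gamma)$ is written $\alpha\gamma$, the class of $(1,\gamma)$ is written $\gamma$, and $0_p$ is the class of $(0,\gamma_{p,p})$. Define $g_p\colon T_pX\times T_pX\to\mathbb{R}$ by $g_p(u,v)=\frac12\big(d_p(u,0_p)^2+d_p(v,0_p)^2-d_p(u,v)^2\big)$; thus $g_p(\alpha\gamma_{p,x},\beta\gamma_{p,y})=\alpha\rho(p,x)\beta\rho(p,y)\cos\angle_p(\gamma_{p,x},\gamma_{p,y})$. Monotone vector fields. $TX=\bigcup_{x\in X}T_xX$. A vector field on $X$ is a map $A\colon X\to2^{TX}$ with $Ax\subset T_xX$ for all $x$. It is monotone if $g_x(x^*,\gamma_{x,y})+g_y(y^*,\gamma_{y,x})\le0$ whenever $x,y\in X$, $x^*\in Ax$, $y^*\in Ay$. A monotone vector field satisfies the surjectivity condition if for all $\lambda>0$ and $x\in X$ there is $z\in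 X$ with $\frac1\lambda\gamma_{z,x}\in Az$. In this case the resolvent is $J_\lambda x=\{z\in X:\frac1\lambda\gamma_{z,x}\in Az\}$; this set is a singleton, and $J_\lambda$ is regarded as a map $X\to X$. $\mathcal{Z}(A)=\{u\in X:0_u\in Au\}$; it is closed and convex. Metric projection. For a nonempty closed convex subset $C$ of an Hadamard space $X$, the metric projection $P_C\colon X\to C$ sends $x$ to the unique point $\hat x\in C$ with $\rho(\hat x,x)=\min_{y\in C}\rho(y,x)$. *)

theory Defs
  imports "HOL-Analysis.Analysis"
begin

subsection \<open>Geodesics and CAT(0) spaces\<close>

text \<open>A geodesic from \<open>p\<close> to \<open>q\<close> is a map on the interval \<open>{0..dist p q}\<close> only.  It is represented by an
  extensional function, so that uniqueness of geodesics is literally \<open>\<exists>!\<close>.\<close>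

definition (in metric_space) is_geodesic :: "'a \<Rightarrow> 'a \<Rightarrow> (real \<Rightarrow> 'a) \<Rightarrow> bool" where
  "is_geodesic p q \<gamma> \<longleftrightarrow>
     \<gamma> \<in> extensional {0..dist p q} \<and> \<gamma> 0 = p \<and> \<gamma> (dist p q) = q \<and>
     (\<forall>s\<in>{0..dist p q}. \<forall>t\<in>{0..dist p q}. dist (\<gamma> s) (\<gamma> t) = \<bar>s - t\<bar>)"

definition (in metric_space) geod :: "'a \<Rightarrow> 'a \<Rightarrow> (real \<Rightarrow> 'a)" where
  "geod p q = (THE \<gamma>. is_geodesic p q \<gamma>)"

text \<open>\<open>geod_comb \<alpha> p q\<close> is the point \<open>(1 - \<alpha>) p \<oplus> \<alpha> q\<close>: the weight \<open>\<alpha>\<close> belongs to the second point.\<close>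

definition (in metric_space) geod_comb :: "real \<Rightarrow> 'a \<Rightarrow> 'a \<Rightarrow> 'a" where
  "geod_comb \<alpha> p q = geod p q (\<alpha> * dist p q)"

class cat0_space = metric_space +
  assumes ex1_geodesic: "\<exists>!\<gamma>. is_geodesic p q \<gamma>"
  and cat0_ineq:
    "\<And>\<alpha> \<beta> x y z (x' :: real^2) (y' :: real^2) (z' :: real^2).
      \<lbrakk>\<alpha> \<in> {0..1}; \<beta> \<in> {0..1};
       dist x y = norm (x' - y'); dist y z = norm (y' - z'); dist z x = norm (z' - x')\<rbrakk> \<Longrightarrow>
      dist (geod_comb \<alpha> x y) (geod_comb \<beta> x z)
        \<le> norm (((1 - \<alpha>) *\<^sub>R x' + \<alpha> *\<^sub>R y') - ((1 - \<beta>) *\<^sub>R x' + \<beta> *\<^sub>R z'))"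

class hadamard_space = cat0_space + complete_space

subsection \<open>Tangent spaces\<close>

definition geodesics_from :: "'a::metric_space \<Rightarrow> (real \<Rightarrow> 'a) set" where
  "geodesics_from p = range (geod p)"

text \<open>The point \<open>x\<close> of \<open>\<gamma> = geod p x\<close>; see \<open>endpoint_geod\<close> below.\<close>

definition endpoint :: "'a::metric_space \<Rightarrow> (real \<Rightarrow> 'a) \<Rightarrow> 'a" where
  "endpoint p \<gamma> = inv (geod p) \<gamma>"

definition comparison_angle :: "'a::metric_space \<Rightarrow> 'a \<Rightarrow> 'a \<Rightarrow> real" where
  "comparison_angle p x y =
     arccos (((dist p x)\<^sup>2 + (dist p y)\<^sup>2 - (dist x y)\<^sup>2) / (2 * dist p x * dist p y))"

definition alexandrov_angle :: "'a::metric_space \<Rightarrow> (real \<Rightarrow> 'a) \<Rightarrow> (real \<Rightarrow> 'a) \<Rightarrow> real" where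
  "alexandrov_angle p \<gamma> \<eta> =
     (if endpoint p \<gamma> \<noteq> p \<and> endpoint p \<eta> \<noteq> p
        then Lim (at_right 0 \<times>\<^sub>F at_right 0) (\<lambda>(s, t). comparison_angle p (\<gamma> s) (\<eta> t))
      else if endpoint p \<gamma> = p \<and> endpoint p \<eta> = p then 0
      else pi / 2)"

definition pre_tdist :: "'a::metric_space \<Rightarrow> real \<times> (real \<Rightarrow> 'a) \<Rightarrow> real \<times> (real \<Rightarrow> 'a) \<Rightarrow> real" where
  "pre_tdist p = (\<lambda>(\<alpha>, \<gamma>) (\<beta>, \<eta>).
     let a = \<alpha> * dist p (endpoint p \<gamma>); b = \<beta> * dist p (endpoint p \<eta>)
     in sqrt (a\<^sup>2 + b\<^sup>2 - 2 * a * b * cos (alexandrov_angle p \<gamma> \<eta>)))"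

definition pre_tangent :: "'a::metric_space \<Rightarrow> (real \<times> (real \<Rightarrow> 'a)) set" where
  "pre_tangent p = {0..} \<times> geodesics_from p"

definition tangent_rel ::
  "'a::metric_space \<Rightarrow> ((real \<times> (real \<Rightarrow> 'a)) \<times> (real \<times> (real \<Rightarrow> 'a))) set" where
  "tangent_rel p = {(a, b). a \<in> pre_tangent p \<and> b \<in> pre_tangent p \<and> pre_tdist p a b = 0}"

type_synonym 'a tvec = "(real \<times> (real \<Rightarrow> 'a)) set"

definition tangent_space :: "'a::metric_space \<Rightarrow> 'a tvec set" where
  "tangent_space p = pre_tangent p // tangent_rel p"

definition tclass :: "'a::metric_space \<Rightarrow> real \<Rightarrow> (real \<Rightarrow> 'a) \<Rightarrow> 'a tvec" where
  "tclass p \<alpha> \<gamma> = tangent_rel p `` {(\<alpha>, \<gamma>)}"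

definition tzero :: "'a::metric_space \<Rightarrow> 'a tvec" where
  "tzero p = tclass p 0 (geod p p)"

definition tdist :: "'a::metric_space \<Rightarrow> 'a tvec \<Rightarrow> 'a tvec \<Rightarrow> real" where
  "tdist p u v = (THE r. \<exists>a\<in>u. \<exists>b\<in>v. r = pre_tdist p a b)"

definition tinner :: "'a::metric_space \<Rightarrow> 'a tvec \<Rightarrow> 'a tvec \<Rightarrow> real" where
  "tinner p u v = 1/2 * ((tdist p u (tzero p))\<^sup>2 + (tdist p v (tzero p))\<^sup>2 - (tdist p u v)\<^sup>2)"

subsection \<open>Monotone vector fields\<close>

text \<open>Every member of a class in \<open>tangent_space p\<close> carries a geodesic starting at \<open>p\<close>, so tangent spaces at
  different points are disjoint, and \<open>TX\<close> is their plain union.\<close>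

definition vector_field :: "('a::metric_space \<Rightarrow> 'a tvec set) \<Rightarrow> bool" where
  "vector_field A \<longleftrightarrow> (\<forall>x. A x \<subseteq> tangent_space x)"

definition monotone_vector_field :: "('a::metric_space \<Rightarrow> 'a tvec set) \<Rightarrow> bool" where
  "monotone_vector_field A \<longleftrightarrow> vector_field A \<and>
     (\<forall>x y. \<forall>x'\<in>A x. \<forall>y'\<in>A y.
        tinner x x' (tclass x 1 (geod x y)) + tinner y y' (tclass y 1 (geod y x)) \<le> 0)"

definition surjectivity_condition :: "('a::metric_space \<Rightarrow> 'a tvec set) \<Rightarrow> bool" where
  "surjectivity_condition A \<longleftrightarrow> (\<forall>l>0. \<forall>x. \<exists>z. tclass z (1 / l) (geod z x) \<in> A z)"

definition resolvent :: "('a::metric_space \<Rightarrow> 'a tvec set) \<Rightarrow> real \<Rightarrow> 'a \<Rightarrow> 'a" where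
  "resolvent A l x = (THE z. tclass z (1 / l) (geod z x) \<in> A z)"

definition zeros :: "('a::metric_space \<Rightarrow> 'a tvec set) \<Rightarrow> 'a set" where
  "zeros A = {u. tzero u \<in> A u}"

definition metric_proj :: "'a::metric_space set \<Rightarrow> 'a \<Rightarrow> 'a" where
  "metric_proj C x = (THE y. y \<in> C \<and> (\<forall>z\<in>C. dist y x \<le> dist z x))"

subsection \<open>The endpoint of a geodesic is well defined\<close>

lemma is_geodesic_geod: "is_geodesic p q (geod p q)" for p q :: "'a::cat0_space"
  unfolding geod_def by (rule theI'[OF ex1_geodesic])

lemma geod_eq_imp_le:
  fixes p x y :: "'a::cat0_space"
  assumes "geod p x = geod p y"
  shows "dist p y \<le> dist p x"
proof (rule ccontr)
  assume "\<not> dist p y \<le> dist p x"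
  then have lt: "dist p x < dist p y" by simp
  define m where "m = (dist p x + dist p y) / 2"
  have m: "dist p x < m" "m < dist p y" using lt by (auto simp: m_def)
  have "0 \<le> dist p x" by simp
  then have m0: "0 \<le> m" using m by linarith
  have ext: "geod p x \<in> extensional {0..dist p x}"
    using is_geodesic_geod[of p x] by (simp add: is_geodesic_def)
  have "geod p x m = undefined" "geod p x (dist p y) = undefined"
    using ext m lt by (auto simp: extensional_def)
  moreover have "dist (geod p y m) (geod p y (dist p y)) = \<bar>m - dist p y\<bar>"
  proof -
    have iso: "\<forall>s\<in>{0..dist p y}. \<forall>t\<in>{0..dist p y}. dist (geod p y s) (geod p y t) = \<bar>s - t\<bar>"
      using is_geodesic_geod[of p y] unfolding is_geodesic_def by blast
    show ?thesis by (rule iso[rule_format]) (use m m0 in auto)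
  qed
  ultimately show False using assms m by simp
qed

lemma inj_geod: "inj (geod p)" for p :: "'a::cat0_space"
proof (rule injI)
  fix x y assume eq: "geod p x = geod p y"
  then have "dist p x = dist p y"
    using geod_eq_imp_le[of p x y] geod_eq_imp_le[of p y x] by simp
  moreover have "geod p x (dist p x) = x" "geod p y (dist p y) = y"
    using is_geodesic_geod[of p x] is_geodesic_geod[of p y] unfolding is_geodesic_def by blast+
  ultimately show "x = y" using eq by metis
qed

lemma endpoint_geod [simp]: "endpoint p (geod p x) = x" for p x :: "'a::cat0_space"
  by (simp add: endpoint_def inj_geod)

end

theory Submission
  imports Defs
begin

text \<open>
  Write \<open>J\<^sub>\<kappa>\<close> for the resolvents and \<open>y\<^sub>n = J\<^bsub>l\<^sub>n\<^esub> x\<^sub>n\<close>.  In a CAT(0) space the Alexandrov angle is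
  at most the comparison angle (\<open>law_of_cosines_le\<close>), so monotonicity of \<open>A\<close> turns into a purely
  metric inequality between two resolvent values \<open>z = J\<^sub>\<kappa> x\<close> and \<open>w = J\<^sub>\<mu> y\<close>, namely
  \<open>monotone_resolvent_ineq\<close>.  To evaluate the inner product on tangent vectors one has to know that
  the distance of tangent vectors is well defined; this follows from \<open>tendsto_pre_tdist\<close>, which
  exhibits that distance as a limit of rescaled distances in the space.

  The inequality has the following consequences.  If \<open>u\<close> is a zero, then
  \<open>dist (J\<^sub>\<kappa> x) u \<le> dist x u\<close>, so the iteration stays bounded.  For fixed \<open>v\<close>, the curve
  \<open>\<kappa> \<mapsto> J\<^sub>\<kappa> v\<close> moves away from \<open>v\<close>, and if it is bounded, it converges as \<open>\<kappa> \<rightarrow> \<infinity>\<close>; the limit is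
  a zero and is the projection \<open>p\<close> of \<open>v\<close> onto the set of zeros (\<open>resolvent_tendsto_proj\<close>).
  Finally, if \<open>x\<^sub>n\<close> is bounded and \<open>l\<^sub>n \<rightarrow> \<infinity>\<close>, then
  \<open>dist (J\<^sub>\<mu> v) v \<le> liminf dist v y\<^sub>n\<close> for every \<open>\<mu>\<close> (\<open>resolvent_dist_eventually_le\<close>).

  Boundedness of \<open>y\<^sub>n\<close> therefore bounds the curve \<open>J\<^sub>\<mu> v\<close> and produces a zero.  Conversely, when
  zeros exist, \<open>a\<^sub>n \<rightarrow> 0\<close> and the sum of the \<open>a\<^sub>n\<close> diverges, letting
  \<open>\<mu> \<rightarrow> \<infinity>\<close> gives \<open>dist p v \<le> liminf dist v y\<^sub>n\<close>.  With this, the inequality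
  \<open>dist_geod_comb_sq_le\<close> becomes the recursion
  \<open>s\<^sub>n\<^sub>+\<^sub>1 \<le> (1 - a\<^sub>n) s\<^sub>n + a\<^sub>n t\<^sub>n\<close> for \<open>s\<^sub>n = (dist x\<^sub>n p)\<^sup>2\<close> with \<open>limsup t\<^sub>n \<le> 0\<close>, which forces
  \<open>s\<^sub>n \<rightarrow> 0\<close> (\<open>Xu_recursion_tendsto_0\<close>).
\<close>

section \<open>Geodesics and the CAT(0) inequality\<close>

lemma geod_0 [simp]: "geod p q 0 = p"
  and geod_dist [simp]: "geod p q (dist p q) = q"
  for p q :: "'a::cat0_space"
  using is_geodesic_geod[of p q] by (auto simp: is_geodesic_def)

lemma dist_geod_geod:
  fixes p q :: "'a::cat0_space"
  assumes "s \<in> {0..dist p q}" "t \<in> {0..dist p q}"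
  shows "dist (geod p q s) (geod p q t) = \<bar>s - t\<bar>"
  using is_geodesic_geod[of p q] assms by (auto simp: is_geodesic_def)

lemma dist_geod_left:
  fixes p q :: "'a::cat0_space"
  assumes "s \<in> {0..dist p q}"
  shows "dist p (geod p q s) = s"
  using dist_geod_geod[of 0 p q s] assms by auto

lemma geod_comb_1 [simp]: "geod_comb 1 p q = q" for p q :: "'a::cat0_space"
  by (simp add: geod_comb_def)

lemma dist_geod_comb_left:
  fixes p q :: "'a::cat0_space"
  assumes "r \<in> {0..1}"
  shows "dist p (geod_comb r p q) = r * dist p q"
  using assms by (simp add: geod_comb_def dist_geod_left mult_left_le_one_le)

lemma geod_geod:
  fixes p q :: "'a::cat0_space"
  assumes s: "s \<in> {0..dist p q}"
  shows "geod p (geod p q s) = restrict (geod p q) {0..s}"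
proof -
  have d: "dist p (geod p q s) = s"
    using s by (rule dist_geod_left)
  have "is_geodesic p (geod p q s) (restrict (geod p q) {0..s})"
    unfolding is_geodesic_def d using s by (auto intro!: dist_geod_geod)
  with is_geodesic_geod ex1_geodesic show ?thesis
    by blast
qed

lemma geod_comb_geod_comb:
  fixes p q :: "'a::cat0_space"
  assumes "r \<in> {0..1}" "s \<in> {0..1}"
  shows "geod_comb r p (geod_comb s p q) = geod_comb (r * s) p q"
proof -
  have s: "s * dist p q \<in> {0..dist p q}"
    using assms by (auto simp: mult_left_le_one_le)
  have "r * (s * dist p q) \<in> {0..s * dist p q}"
    using assms by (auto simp: mult_left_le_one_le)
  then show ?thesis
    using dist_geod_left[OF s] by (simp add: geod_comb_def geod_geod[OF s] mult.assoc)
qed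

lemma comparison_triangle_exists:
  fixes x y z :: "'a::metric_space"
  obtains x' y' z' :: "real^2"
  where "dist x y = norm (x' - y')" "dist y z = norm (y' - z')" "dist z x = norm (z' - x')"
proof (cases "dist x y = 0")
  case True
  then show ?thesis
    using that[of 0 0 "vector [dist x z, 0]"]
    by (auto simp: norm_eq_sqrt_inner inner_vec_def sum_2 power2_eq_square[symmetric] dist_commute)
next
  case False
  define b c d u where "b = dist x z" and "c = dist x y" and "d = dist y z"
    and "u = (b\<^sup>2 + c\<^sup>2 - d\<^sup>2) / (2 * c)"
  have c: "c > 0" and b: "b \<ge> 0" and d: "d \<ge> 0"
    using False by (auto simp: b_def c_def d_def)
  have t: "d \<le> b + c" "b \<le> c + d" "c \<le> b + d"
    using dist_triangle[of y z x] dist_triangle[of x z y] dist_triangle[of x y z]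
    by (auto simp: b_def c_def d_def dist_commute)
  have "d\<^sup>2 \<le> (b + c)\<^sup>2" "(b - c)\<^sup>2 \<le> d\<^sup>2"
    using t b c d by (auto intro!: power_mono abs_le_square_iff[THEN iffD1])
  then have "u \<le> b" "- b \<le> u"
    using c by (auto simp: u_def field_simps power2_eq_square)
  then have u: "u\<^sup>2 \<le> b\<^sup>2"
    using abs_le_square_iff[of u b] b by auto
  have cu: "2 * c * u = b\<^sup>2 + c\<^sup>2 - d\<^sup>2"
    using c by (simp add: u_def)
  have "sqrt (c\<^sup>2) = c" "sqrt ((c - u)\<^sup>2 + (b\<^sup>2 - u\<^sup>2)) = d" "sqrt (u\<^sup>2 + (b\<^sup>2 - u\<^sup>2)) = b"
    using b c d cu by (auto simp: power2_diff)
  then show ?thesis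
    using that[of 0 "vector [c, 0]" "vector [u, sqrt (b\<^sup>2 - u\<^sup>2)]"] u
    by (simp add: norm_eq_sqrt_inner inner_vec_def sum_2 power2_eq_square[symmetric]
        b_def[symmetric] c_def[symmetric] d_def[symmetric] dist_commute[of z x])
qed

text \<open>The CAT(0) inequality with the comparison triangle eliminated: the right-hand side is the squared
  distance of the comparison points, expressed through the three side lengths.\<close>

lemma cat0_two_sides:
  fixes p x y :: "'a::cat0_space"
  assumes "s \<in> {0..1}" "t \<in> {0..1}"
  shows "(dist (geod_comb s p x) (geod_comb t p y))\<^sup>2
    \<le> (s * dist p x)\<^sup>2 + (t * dist p y)\<^sup>2
      - s * t * ((dist p x)\<^sup>2 + (dist p y)\<^sup>2 - (dist x y)\<^sup>2)"
proof -
  obtain p' x' y' :: "real^2" where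
    e: "dist p x = norm (p' - x')" "dist x y = norm (x' - y')" "dist y p = norm (y' - p')"
    by (rule comparison_triangle_exists)
  define X Y where "X = x' - p'" and "Y = y' - p'"
  have n: "dist p x = norm X" "dist x y = norm (X - Y)" "dist p y = norm Y"
    using e by (auto simp: X_def Y_def norm_minus_commute dist_commute)
  have "dist (geod_comb s p x) (geod_comb t p y)
      \<le> norm (((1 - s) *\<^sub>R p' + s *\<^sub>R x') - ((1 - t) *\<^sub>R p' + t *\<^sub>R y'))"
    using assms e by (rule cat0_ineq)
  also have "((1 - s) *\<^sub>R p' + s *\<^sub>R x') - ((1 - t) *\<^sub>R p' + t *\<^sub>R y') = s *\<^sub>R X - t *\<^sub>R Y"
    by (simp add: X_def Y_def algebra_simps)
  finally have "(dist (geod_comb s p x) (geod_comb t p y))\<^sup>2 \<le> (norm (s *\<^sub>R X - t *\<^sub>R Y))\<^sup>2"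
    by (rule power_mono) simp
  also have "\<dots> = (s * norm X)\<^sup>2 + (t * norm Y)\<^sup>2
      - s * t * ((norm X)\<^sup>2 + (norm Y)\<^sup>2 - (norm (X - Y))\<^sup>2)"
    unfolding power_mult_distrib power2_norm_eq_inner
    by (simp add: inner_diff inner_commute power2_eq_square algebra_simps)
  finally show ?thesis
    by (simp add: n)
qed

text \<open>The case in which one of the two points is the vertex itself; on the comparison triangle this is
  Stewart's theorem.\<close>

lemma dist_geod_comb_sq_le:
  fixes x y z :: "'a::cat0_space"
  assumes "t \<in> {0..1}"
  shows "(dist (geod_comb t x y) z)\<^sup>2
    \<le> (1 - t) * (dist x z)\<^sup>2 + t * (dist y z)\<^sup>2 - t * (1 - t) * (dist x y)\<^sup>2"
  using cat0_two_sides[OF assms, of 1 x y z] by (simp add: power2_eq_square algebra_simps)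

section \<open>The Alexandrov angle as a limit\<close>

lemma tendsto_prod_at_right_antimono:
  fixes f :: "real \<Rightarrow> real \<Rightarrow> real"
  assumes bound: "\<And>s t. s \<in> {0<..1} \<Longrightarrow> t \<in> {0<..1} \<Longrightarrow> f s t \<le> M"
    and mono: "\<And>s t r q. s \<in> {0<..1} \<Longrightarrow> t \<in> {0<..1} \<Longrightarrow> r \<in> {0<..s} \<Longrightarrow> q \<in> {0<..t}
      \<Longrightarrow> f s t \<le> f r q"
  obtains L where "((\<lambda>(s, t). f s t) \<longlongrightarrow> L) (at_right 0 \<times>\<^sub>F at_right 0)" "f 1 1 \<le> L"
proof
  define V where "V = (\<lambda>(s, t). f s t) ` ({0<..1} \<times> {0<..1})"
  have bdd: "bdd_above V"
    using bound by (auto simp: V_def intro!: bdd_aboveI[of _ M])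
  show "f 1 1 \<le> Sup V"
    by (rule cSup_upper[OF _ bdd]) (auto simp: V_def)
  show "((\<lambda>(s, t). f s t) \<longlongrightarrow> Sup V) (at_right 0 \<times>\<^sub>F at_right 0)"
  proof (rule tendstoI)
    fix e :: real assume "e > 0"
    moreover have "V \<noteq> {}"
      by (auto simp: V_def)
    ultimately obtain v where "v \<in> V" "Sup V - e < v"
      using less_cSup_iff[OF _ bdd, of "Sup V - e"] by auto
    then obtain s t where st: "s \<in> {0<..1}" "t \<in> {0<..1}" "Sup V - e < f s t"
      by (auto simp: V_def)
    have "\<forall>\<^sub>F r in at_right 0. r \<in> {0<..s}" "\<forall>\<^sub>F q in at_right 0. q \<in> {0<..t}"
      using st by (auto simp: eventually_at_right_field intro: exI[of _ s] exI[of _ t])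
    then have "\<forall>\<^sub>F z in at_right 0 \<times>\<^sub>F at_right 0. fst z \<in> {0<..s} \<and> snd z \<in> {0<..t}"
      by (rule eventually_prodI)
    then show "\<forall>\<^sub>F z in at_right 0 \<times>\<^sub>F at_right 0. dist (case z of (s, t) \<Rightarrow> f s t) (Sup V) < e"
    proof eventually_elim
      case (elim z)
      then have "f s t \<le> f (fst z) (snd z)"
        using st by (intro mono) auto
      moreover have "f (fst z) (snd z) \<le> Sup V"
        using elim st by (intro cSup_upper[OF _ bdd]) (force simp: V_def)
      ultimately show ?case
        using st by (auto simp: dist_real_def split_beta)
    qed
  qed
qed

text \<open>The quantity \<open>dist p x * dist p y * cos \<theta>\<close>, where \<open>\<theta>\<close> is the comparison angle at \<open>p\<close> of
  the points \<open>(1 - s) p \<oplus> s x\<close> and \<open>(1 - t) p \<oplus> t y\<close>.  Multiplying the cosine by the two lengths and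
  parametrizing the geodesics over \<open>{0..1}\<close> gives an expression that needs no exception for \<open>x = p\<close>
  or \<open>y = p\<close>.\<close>

definition dir_quot :: "'a::metric_space \<Rightarrow> 'a \<Rightarrow> 'a \<Rightarrow> real \<Rightarrow> real \<Rightarrow> real" where
  "dir_quot p x y s t = ((s * dist p x)\<^sup>2 + (t * dist p y)\<^sup>2
      - (dist (geod_comb s p x) (geod_comb t p y))\<^sup>2) / (2 * s * t)"

lemma abs_law_of_cosines_le:
  fixes p x y :: "'a::metric_space"
  shows "\<bar>(dist p x)\<^sup>2 + (dist p y)\<^sup>2 - (dist x y)\<^sup>2\<bar> \<le> 2 * dist p x * dist p y"
proof -
  have "(dist x y)\<^sup>2 \<le> (dist p x + dist p y)\<^sup>2"
    using dist_triangle[of x y p] by (intro power_mono) (auto simp: dist_commute)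
  moreover have "(dist p x - dist p y)\<^sup>2 \<le> (dist x y)\<^sup>2"
    using dist_triangle[of p x y] dist_triangle[of p y x]
    by (intro abs_le_square_iff[THEN iffD1]) (auto simp: dist_commute)
  ultimately show ?thesis
    by (simp add: power2_sum power2_diff)
qed

lemma abs_dir_quot_le:
  fixes p x y :: "'a::cat0_space"
  assumes "s \<in> {0<..1}" "t \<in> {0<..1}"
  shows "\<bar>dir_quot p x y s t\<bar> \<le> dist p x * dist p y"
  using assms abs_law_of_cosines_le[of p "geod_comb s p x" "geod_comb t p y"]
  by (simp add: dir_quot_def dist_geod_comb_left abs_mult divide_le_eq mult_ac)

text \<open>Comparison angles shrink towards the vertex, so the Alexandrov angle exists and is at most the
  comparison angle.\<close>

lemma dir_quot_antimono:
  fixes p x y :: "'a::cat0_space"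
  assumes st: "s \<in> {0<..1}" "t \<in> {0<..1}" and rq: "r \<in> {0<..s}" "q \<in> {0<..t}"
  shows "dir_quot p x y s t \<le> dir_quot p x y r q"
proof -
  define k m where "k = r / s" and "m = q / t"
  have km: "k \<in> {0..1}" "m \<in> {0..1}" "k > 0" "m > 0" and r: "r = k * s" and q: "q = m * t"
    using st rq by (auto simp: k_def m_def)
  define D where "D = (dist (geod_comb s p x) (geod_comb t p y))\<^sup>2"
  have "(dist (geod_comb r p x) (geod_comb q p y))\<^sup>2
      \<le> (k * (s * dist p x))\<^sup>2 + (m * (t * dist p y))\<^sup>2
        - k * m * ((s * dist p x)\<^sup>2 + (t * dist p y)\<^sup>2 - D)"
    using cat0_two_sides[OF km(1,2), of p "geod_comb s p x" "geod_comb t p y"] km st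
    by (simp add: geod_comb_geod_comb dist_geod_comb_left r q D_def)
  then have "k * m * ((s * dist p x)\<^sup>2 + (t * dist p y)\<^sup>2 - D)
      \<le> (r * dist p x)\<^sup>2 + (q * dist p y)\<^sup>2 - (dist (geod_comb r p x) (geod_comb q p y))\<^sup>2"
    by (simp add: r q mult.assoc)
  then have "k * m * ((s * dist p x)\<^sup>2 + (t * dist p y)\<^sup>2 - D) / (2 * r * q) \<le> dir_quot p x y r q"
    unfolding dir_quot_def using rq by (intro divide_right_mono) auto
  also have "k * m * ((s * dist p x)\<^sup>2 + (t * dist p y)\<^sup>2 - D) / (2 * r * q) = dir_quot p x y s t"
    using st km by (simp add: r q dir_quot_def D_def field_simps)
  finally show ?thesis .
qed

lemma filterlim_divide_at_right_0:
  fixes c :: real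
  assumes "c > 0"
  shows "filterlim (\<lambda>t. t / c) (at_right 0) (at_right 0)"
  unfolding filterlim_at using assms
  by (auto simp: eventually_at_right_field intro!: tendsto_eq_intros exI[of _ 1])

text \<open>The first part says that the \<open>Lim\<close> in the definition of the Alexandrov angle is a genuine limit;
  the second bounds the cosine of the Alexandrov angle below by that of the comparison angle.\<close>

lemma cos_alexandrov_angle:
  fixes p x y :: "'a::cat0_space"
  assumes ne: "x \<noteq> p" "y \<noteq> p"
  defines "G \<equiv> dist p x * dist p y * cos (alexandrov_angle p (geod p x) (geod p y))"
  shows "((\<lambda>(s, t). dir_quot p x y s t) \<longlongrightarrow> G) (at_right 0 \<times>\<^sub>F at_right 0)"
    and "((dist p x)\<^sup>2 + (dist p y)\<^sup>2 - (dist x y)\<^sup>2) / 2 \<le> G"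
proof -
  let ?F = "at_right (0::real) \<times>\<^sub>F at_right (0::real)"
  define c b where "c = dist p x" and "b = dist p y"
  have c: "c > 0" and b: "b > 0"
    using ne by (auto simp: c_def b_def)
  obtain L where L: "((\<lambda>(s, t). dir_quot p x y s t) \<longlongrightarrow> L) ?F" and L1: "dir_quot p x y 1 1 \<le> L"
    by (rule tendsto_prod_at_right_antimono[of "dir_quot p x y" "c * b"])
      (use abs_dir_quot_le[of _ _ p x y] abs_le_D1 c_def b_def in blast,
        rule dir_quot_antimono, auto)
  let ?q = "\<lambda>z. dir_quot p x y (fst z / c) (snd z / b) / (c * b)"
  \<comment> \<open>The angle is defined with arc length parameters, which are rescaled by the side lengths.\<close>
  have lim: "filterlim (\<lambda>z. (fst z / c, snd z / b)) ?F ?F"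
    by (intro filterlim_Pair filterlim_compose[OF filterlim_divide_at_right_0]
        filterlim_fst filterlim_snd c b)
  have q: "(?q \<longlongrightarrow> L / (c * b)) ?F"
    using filterlim_compose[OF L lim] b c by (auto simp: split_beta intro!: tendsto_intros)
  have "\<forall>\<^sub>F s in at_right 0. s \<in> {0<..c}" "\<forall>\<^sub>F t in at_right 0. t \<in> {0<..b}"
    using b c by (auto simp: eventually_at_right_field intro: exI[of _ c] exI[of _ b])
  then have small: "\<forall>\<^sub>F z in ?F. fst z \<in> {0<..c} \<and> snd z \<in> {0<..b}"
    by (rule eventually_prodI)
  then have range: "\<forall>\<^sub>F z in ?F. ?q z \<in> {-1..1}"
  proof eventually_elim
    case (elim z)
    then have "\<bar>dir_quot p x y (fst z / c) (snd z / b)\<bar> \<le> c * b"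
      using abs_dir_quot_le[of "fst z / c" "snd z / b" p x y] b c by (simp add: b_def c_def)
    then show ?case
      using b c by (auto simp: field_simps abs_le_iff)
  qed
  have nontriv: "?F \<noteq> bot"
    by (simp add: prod_filter_eq_bot)
  have L_range: "L / (c * b) \<in> {-1..1}"
    by (rule Lim_in_closed_set[OF closed_atLeastAtMost range nontriv q])
  have "((\<lambda>z. arccos (?q z)) \<longlongrightarrow> arccos (L / (c * b))) ?F"
    by (rule continuous_on_tendsto_compose[OF continuous_on_arccos' q L_range range])
  moreover have "\<forall>\<^sub>F z in ?F. arccos (?q z)
      = (case z of (s, t) \<Rightarrow> comparison_angle p (geod p x s) (geod p y t))"
    using small
  proof eventually_elim
    case (elim z)
    then have "dist p (geod p x (fst z)) = fst z" "dist p (geod p y (snd z)) = snd z"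
      by (auto simp: dist_geod_left b_def c_def)
    with b c elim show ?case
      by (simp add: split_beta dir_quot_def comparison_angle_def geod_comb_def b_def[symmetric]
          c_def[symmetric])
  qed
  ultimately have "((\<lambda>(s, t). comparison_angle p (geod p x s) (geod p y t))
      \<longlongrightarrow> arccos (L / (c * b))) ?F"
    by (rule Lim_transform_eventually)
  then have "alexandrov_angle p (geod p x) (geod p y) = arccos (L / (c * b))"
    using ne tendsto_Lim[OF nontriv] by (simp add: alexandrov_angle_def)
  then have "G = L"
    using L_range b c by (simp add: G_def b_def[symmetric] c_def[symmetric])
  then show "((\<lambda>(s, t). dir_quot p x y s t) \<longlongrightarrow> G) ?F"
    and "((dist p x)\<^sup>2 + (dist p y)\<^sup>2 - (dist x y)\<^sup>2) / 2 \<le> G"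
    using L L1 by (auto simp: dir_quot_def)
qed

text \<open>If one of the points is \<open>p\<close>, both sides vanish, whatever value the angle has by convention.\<close>

lemma law_of_cosines_le:
  fixes p x y :: "'a::cat0_space"
  shows "((dist p x)\<^sup>2 + (dist p y)\<^sup>2 - (dist x y)\<^sup>2) / 2
    \<le> dist p x * dist p y * cos (alexandrov_angle p (geod p x) (geod p y))"
  using cos_alexandrov_angle(2)[of x p y] by (cases "x = p \<or> y = p") (auto simp: dist_commute)

section \<open>Tangent spaces\<close>

lemma eventually_mult_at_right_0:
  fixes \<alpha> :: real
  assumes "\<alpha> \<ge> 0"
  shows "\<forall>\<^sub>F t in at_right 0. t > 0 \<and> \<alpha> * t \<in> {0..1}"
proof -
  have "((\<lambda>t. \<alpha> * t) \<longlongrightarrow> 0) (at_right 0)"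
    by (auto intro!: tendsto_eq_intros)
  then have "\<forall>\<^sub>F t in at_right 0. \<alpha> * t < 1"
    by (rule order_tendstoD) simp
  then show ?thesis
    using eventually_at_right_less[of 0] by eventually_elim (use assms in auto)
qed

lemma filterlim_mult_at_right_0:
  fixes \<alpha> :: real
  assumes "\<alpha> > 0"
  shows "filterlim (\<lambda>t. \<alpha> * t) (at_right 0) (at_right 0)"
  using filterlim_divide_at_right_0[of "1 / \<alpha>"] assms by (simp add: mult.commute)

lemma pre_tdist_geod:
  fixes p x y :: "'a::cat0_space"
  shows "pre_tdist p (\<alpha>, geod p x) (\<beta>, geod p y) =
    sqrt ((\<alpha> * dist p x)\<^sup>2 + (\<beta> * dist p y)\<^sup>2
      - 2 * \<alpha> * \<beta> * (dist p x * dist p y * cos (alexandrov_angle p (geod p x) (geod p y))))"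
  by (simp add: pre_tdist_def Let_def mult_ac)

text \<open>The pseudometric on \<open>pre_tangent p\<close> is the rate at which two geodesics diverge.  Hence it inherits
  symmetry and the triangle inequality from the metric of the space, without an appeal to the
  triangle inequality for angles.\<close>

lemma tendsto_pre_tdist:
  fixes p x y :: "'a::cat0_space"
  assumes nonneg: "\<alpha> \<ge> 0" "\<beta> \<ge> 0"
  shows "((\<lambda>t. dist (geod_comb (\<alpha> * t) p x) (geod_comb (\<beta> * t) p y) / t)
    \<longlongrightarrow> pre_tdist p (\<alpha>, geod p x) (\<beta>, geod p y)) (at_right 0)"
proof -
  let ?f = "\<lambda>t. dist (geod_comb (\<alpha> * t) p x) (geod_comb (\<beta> * t) p y) / t"
  have ev: "\<forall>\<^sub>F t in at_right 0. t > 0 \<and> \<alpha> * t \<in> {0..1} \<and> \<beta> * t \<in> {0..1}"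
    using nonneg[THEN eventually_mult_at_right_0] by eventually_elim auto
  consider "\<alpha> * dist p x = 0" | "\<beta> * dist p y = 0"
    | "\<alpha> > 0" "\<beta> > 0" "x \<noteq> p" "y \<noteq> p"
    using nonneg by fastforce
  then show ?thesis
  proof cases
    case 1
    have "\<forall>\<^sub>F t in at_right 0. pre_tdist p (\<alpha>, geod p x) (\<beta>, geod p y) = ?f t"
      using ev
    proof eventually_elim
      case (elim t)
      then have "dist p (geod_comb (\<alpha> * t) p x) = 0"
        using 1 by (auto simp: dist_geod_comb_left)
      then show ?case
        using elim 1 nonneg by (auto simp: pre_tdist_geod dist_geod_comb_left)
    qed
    then show ?thesis
      by (rule Lim_transform_eventually[OF tendsto_const])
  next
    case 2
    have "\<forall>\<^sub>F t in at_right 0. pre_tdist p (\<alpha>, geod p x) (\<beta>, geod p y) = ?f t"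
      using ev
    proof eventually_elim
      case (elim t)
      then have "dist p (geod_comb (\<beta> * t) p y) = 0"
        using 2 by (auto simp: dist_geod_comb_left)
      then show ?case
        using elim 2 nonneg dist_geod_comb_left[of "\<alpha> * t" p x]
        by (auto simp: pre_tdist_geod dist_commute)
    qed
    then show ?thesis
      by (rule Lim_transform_eventually[OF tendsto_const])
  next
    case 3
    let ?G = "dist p x * dist p y * cos (alexandrov_angle p (geod p x) (geod p y))"
    have "filterlim (\<lambda>t. (\<alpha> * t, \<beta> * t)) (at_right 0 \<times>\<^sub>F at_right 0) (at_right 0)"
      using 3 by (intro filterlim_Pair filterlim_mult_at_right_0)
    from filterlim_compose[OF cos_alexandrov_angle(1)[OF 3(3,4)] this]
    have "((\<lambda>t. dir_quot p x y (\<alpha> * t) (\<beta> * t)) \<longlongrightarrow> ?G) (at_right 0)"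
      by simp
    then have "((\<lambda>t. sqrt ((\<alpha> * dist p x)\<^sup>2 + (\<beta> * dist p y)\<^sup>2
        - 2 * \<alpha> * \<beta> * dir_quot p x y (\<alpha> * t) (\<beta> * t)))
        \<longlongrightarrow> pre_tdist p (\<alpha>, geod p x) (\<beta>, geod p y)) (at_right 0)"
      unfolding pre_tdist_geod by (intro tendsto_intros)
    moreover have "\<forall>\<^sub>F t in at_right 0. sqrt ((\<alpha> * dist p x)\<^sup>2 + (\<beta> * dist p y)\<^sup>2
        - 2 * \<alpha> * \<beta> * dir_quot p x y (\<alpha> * t) (\<beta> * t)) = ?f t"
      using ev
    proof eventually_elim
      case (elim t)
      then have "(\<alpha> * dist p x)\<^sup>2 + (\<beta> * dist p y)\<^sup>2 - 2 * \<alpha> * \<beta> * dir_quot p x y (\<alpha> * t) (\<beta> * t)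
          = (?f t)\<^sup>2"
        using 3 by (simp add: dir_quot_def field_simps power2_eq_square)
      with elim show ?case
        by simp
    qed
    ultimately show ?thesis
      by (rule Lim_transform_eventually)
  qed
qed

lemma pre_tangentE:
  fixes p :: "'a::cat0_space"
  assumes "u \<in> pre_tangent p"
  obtains \<alpha> x where "\<alpha> \<ge> 0" "u = (\<alpha>, geod p x)"
  using assms by (auto simp: pre_tangent_def geodesics_from_def)

lemma geod_in_pre_tangent [simp]: "(\<alpha>, geod p x) \<in> pre_tangent p \<longleftrightarrow> \<alpha> \<ge> 0"
  by (auto simp: pre_tangent_def geodesics_from_def)

lemma pre_tdist_self:
  fixes p :: "'a::cat0_space"
  assumes "u \<in> pre_tangent p"
  shows "pre_tdist p u u = 0"
  using assms
proof (rule pre_tangentE)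
  fix \<alpha> x assume "\<alpha> \<ge> 0" "u = (\<alpha>, geod p x)"
  then show ?thesis
    using tendsto_pre_tdist[of \<alpha> \<alpha> p x x] by (simp add: tendsto_const_iff)
qed

lemma pre_tdist_commute:
  fixes p :: "'a::cat0_space"
  assumes "u \<in> pre_tangent p" "w \<in> pre_tangent p"
  shows "pre_tdist p u w = pre_tdist p w u"
proof -
  from assms obtain \<alpha> x \<beta> y where "\<alpha> \<ge> 0" "u = (\<alpha>, geod p x)" "\<beta> \<ge> 0" "w = (\<beta>, geod p y)"
    by (auto elim!: pre_tangentE)
  then show ?thesis
    using tendsto_pre_tdist[of \<alpha> \<beta> p x y] tendsto_pre_tdist[of \<beta> \<alpha> p y x]
    by (auto simp: dist_commute intro: tendsto_unique[OF trivial_limit_at_right_real])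
qed

lemma pre_tdist_triangle:
  fixes p :: "'a::cat0_space"
  assumes "u \<in> pre_tangent p" "v \<in> pre_tangent p" "w \<in> pre_tangent p"
  shows "pre_tdist p u w \<le> pre_tdist p u v + pre_tdist p v w"
proof -
  from assms obtain \<alpha> x \<beta> y \<gamma> z where nonneg: "\<alpha> \<ge> 0" "\<beta> \<ge> 0" "\<gamma> \<ge> 0"
    and uvw: "u = (\<alpha>, geod p x)" "v = (\<beta>, geod p y)" "w = (\<gamma>, geod p z)"
    by (auto elim!: pre_tangentE)
  show ?thesis
    unfolding uvw
  proof (rule tendsto_le[OF trivial_limit_at_right_real])
    show "\<forall>\<^sub>F t in at_right 0. dist (geod_comb (\<alpha> * t) p x) (geod_comb (\<gamma> * t) p z) / t
      \<le> dist (geod_comb (\<alpha> * t) p x) (geod_comb (\<beta> * t) p y) / t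
        + dist (geod_comb (\<beta> * t) p y) (geod_comb (\<gamma> * t) p z) / t"
      using eventually_at_right_less[of 0]
      by eventually_elim
        (auto simp: add_divide_distrib[symmetric] intro!: divide_right_mono dist_triangle)
  qed (intro tendsto_intros tendsto_pre_tdist nonneg)+
qed

text \<open>The distance of two classes does not depend on the representatives, so the definite description in
  \<open>tdist\<close> has a value.\<close>

lemma tdist_tclass:
  fixes p x y :: "'a::cat0_space"
  assumes nonneg: "\<alpha> \<ge> 0" "\<beta> \<ge> 0"
  shows "tdist p (tclass p \<alpha> (geod p x)) (tclass p \<beta> (geod p y))
    = pre_tdist p (\<alpha>, geod p x) (\<beta>, geod p y)"
  unfolding tdist_def
proof (rule the_equality)
  let ?u = "(\<alpha>, geod p x)" and ?w = "(\<beta>, geod p y)"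
  have u: "?u \<in> pre_tangent p" and w: "?w \<in> pre_tangent p"
    using nonneg by auto
  show "\<exists>a\<in>tclass p \<alpha> (geod p x). \<exists>b\<in>tclass p \<beta> (geod p y). pre_tdist p ?u ?w = pre_tdist p a b"
  proof (intro bexI)
    show "pre_tdist p ?u ?w = pre_tdist p ?u ?w"
      by (rule refl)
    show "?u \<in> tclass p \<alpha> (geod p x)" "?w \<in> tclass p \<beta> (geod p y)"
      using u w by (simp_all add: tclass_def tangent_rel_def pre_tdist_self)
  qed
  fix r assume "\<exists>a\<in>tclass p \<alpha> (geod p x). \<exists>b\<in>tclass p \<beta> (geod p y). r = pre_tdist p a b"
  then obtain a b where ab: "a \<in> pre_tangent p" "b \<in> pre_tangent p"
    and zero: "pre_tdist p ?u a = 0" "pre_tdist p ?w b = 0" and r: "r = pre_tdist p a b"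
    by (auto simp: tclass_def tangent_rel_def)
  have "pre_tdist p a b \<le> pre_tdist p ?u ?w"
    using pre_tdist_triangle[OF ab(1) u ab(2)] pre_tdist_triangle[OF u w ab(2)]
      pre_tdist_commute[OF ab(1) u] zero by simp
  moreover have "pre_tdist p ?u ?w \<le> pre_tdist p a b"
    using pre_tdist_triangle[OF u ab(1) w] pre_tdist_triangle[OF ab w]
      pre_tdist_commute[OF ab(2) w] zero by simp
  ultimately show "r = pre_tdist p ?u ?w"
    using r by simp
qed

lemma pre_tdist_sq:
  fixes p x y :: "'a::cat0_space"
  assumes "\<alpha> \<ge> 0" "\<beta> \<ge> 0"
  shows "(pre_tdist p (\<alpha>, geod p x) (\<beta>, geod p y))\<^sup>2 =
    (\<alpha> * dist p x)\<^sup>2 + (\<beta> * dist p y)\<^sup>2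
      - 2 * \<alpha> * \<beta> * (dist p x * dist p y * cos (alexandrov_angle p (geod p x) (geod p y)))"
proof -
  let ?a = "\<alpha> * dist p x" and ?b = "\<beta> * dist p y"
    and ?c = "cos (alexandrov_angle p (geod p x) (geod p y))"
  have "(?a * ?b) * ?c \<le> ?a * ?b"
    using assms by (intro mult_left_le) auto
  moreover have "(?a - ?b)\<^sup>2 \<ge> 0"
    by simp
  ultimately have "?a\<^sup>2 + ?b\<^sup>2 - 2 * \<alpha> * \<beta> * (dist p x * dist p y * ?c) \<ge> 0"
    by (simp add: power2_diff mult_ac)
  then show ?thesis
    by (simp add: pre_tdist_geod)
qed

lemma tinner_tclass:
  fixes p x y :: "'a::cat0_space"
  assumes "\<alpha> \<ge> 0" "\<beta> \<ge> 0"
  shows "tinner p (tclass p \<alpha> (geod p x)) (tclass p \<beta> (geod p y)) =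
    \<alpha> * \<beta> * (dist p x * dist p y * cos (alexandrov_angle p (geod p x) (geod p y)))"
  using assms by (simp add: tinner_def tzero_def tdist_tclass pre_tdist_sq)

lemma tzero_eq:
  fixes u :: "'a::cat0_space"
  assumes "\<alpha> \<ge> 0"
  shows "tzero u = tclass u \<alpha> (geod u u)"
proof -
  have "pre_tdist u (0, geod u u) b = pre_tdist u (\<alpha>, geod u u) b" for b
    by (cases b) (simp add: pre_tdist_def Let_def)
  with assms show ?thesis
    by (auto simp: tzero_def tclass_def tangent_rel_def)
qed

section \<open>Monotone vector fields and resolvents\<close>

text \<open>Monotonicity between \<open>z = J\<^sub>\<kappa> x\<close> and \<open>w = J\<^sub>\<mu> y\<close>, with the cosines of the Alexandrov angles
  bounded below by those of the comparison angles.  This is the only consequence of monotonicity that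
  is used below.\<close>

lemma monotone_resolvent_ineq:
  fixes A :: "'a::cat0_space \<Rightarrow> 'a tvec set"
  assumes mono: "monotone_vector_field A" and pos: "\<kappa> > 0" "\<mu> > 0"
    and z: "tclass z (1 / \<kappa>) (geod z x) \<in> A z" and w: "tclass w (1 / \<mu>) (geod w y) \<in> A w"
  shows "\<mu> * ((dist z x)\<^sup>2 + (dist z w)\<^sup>2 - (dist x w)\<^sup>2)
    + \<kappa> * ((dist w y)\<^sup>2 + (dist z w)\<^sup>2 - (dist y z)\<^sup>2) \<le> 0"
proof -
  have "tinner z (tclass z (1 / \<kappa>) (geod z x)) (tclass z 1 (geod z w))
      + tinner w (tclass w (1 / \<mu>) (geod w y)) (tclass w 1 (geod w z)) \<le> 0"
    using mono z w by (auto simp: monotone_vector_field_def)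
  then have "1 / \<kappa> * (dist z x * dist z w * cos (alexandrov_angle z (geod z x) (geod z w)))
      + 1 / \<mu> * (dist w y * dist w z * cos (alexandrov_angle w (geod w y) (geod w z))) \<le> 0"
    using pos by (simp add: tinner_tclass)
  moreover have "1 / \<kappa> * (((dist z x)\<^sup>2 + (dist z w)\<^sup>2 - (dist x w)\<^sup>2) / 2)
      \<le> 1 / \<kappa> * (dist z x * dist z w * cos (alexandrov_angle z (geod z x) (geod z w)))"
    using pos by (intro mult_left_mono law_of_cosines_le) auto
  moreover have "1 / \<mu> * (((dist w y)\<^sup>2 + (dist w z)\<^sup>2 - (dist y z)\<^sup>2) / 2)
      \<le> 1 / \<mu> * (dist w y * dist w z * cos (alexandrov_angle w (geod w y) (geod w z)))"
    using pos by (intro mult_left_mono law_of_cosines_le) auto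
  ultimately have "1 / \<kappa> * (((dist z x)\<^sup>2 + (dist z w)\<^sup>2 - (dist x w)\<^sup>2) / 2)
      + 1 / \<mu> * (((dist w y)\<^sup>2 + (dist w z)\<^sup>2 - (dist y z)\<^sup>2) / 2) \<le> 0"
    by linarith
  then show ?thesis
    using pos by (simp add: field_simps dist_commute[of w z])
qed

text \<open>A zero is a point fixed by the resolvents: the tangent vectors \<open>\<alpha> \<gamma>\<^bsub>u,u\<^esub>\<close> are all equal to
  \<open>0\<^sub>u\<close>.\<close>

lemma zero_iff_tclass:
  fixes u :: "'a::cat0_space"
  assumes "\<kappa> > 0"
  shows "u \<in> zeros A \<longleftrightarrow> tclass u (1 / \<kappa>) (geod u u) \<in> A u"
  using tzero_eq[of "1 / \<kappa>" u] assms by (simp add: zeros_def)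

context
  fixes A :: "'a::cat0_space \<Rightarrow> 'a tvec set"
  assumes mono: "monotone_vector_field A" and surj: "surjectivity_condition A"
begin

lemma resolvent_unique:
  assumes pos: "\<kappa> > 0"
    and z: "tclass z (1 / \<kappa>) (geod z x) \<in> A z" and w: "tclass w (1 / \<kappa>) (geod w x) \<in> A w"
  shows "w = z"
proof -
  have "\<kappa> * (dist z w)\<^sup>2 \<le> 0"
    using monotone_resolvent_ineq[OF mono pos pos z w] by (simp add: dist_commute algebra_simps)
  then show ?thesis
    using pos by (simp add: mult_le_0_iff)
qed

lemma resolvent_mem:
  assumes "\<kappa> > 0"
  shows "tclass (resolvent A \<kappa> x) (1 / \<kappa>) (geod (resolvent A \<kappa> x) x) \<in> A (resolvent A \<kappa> x)"
proof -
  obtain z where z: "tclass z (1 / \<kappa>) (geod z x) \<in> A z"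
    using surj assms by (auto simp: surjectivity_condition_def)
  show ?thesis
    unfolding resolvent_def by (rule theI') (use z resolvent_unique[OF assms z] in blast)
qed

lemma resolvent_fixed_imp_zero:
  assumes "\<kappa> > 0" "resolvent A \<kappa> u = u"
  shows "u \<in> zeros A"
  unfolding zero_iff_tclass[OF assms(1)] using resolvent_mem[OF assms(1), of u] unfolding assms(2) .

lemma resolvent_ineq:
  fixes x y :: 'a
  assumes "\<kappa> > 0" "\<mu> > 0"
  defines "z \<equiv> resolvent A \<kappa> x" and "w \<equiv> resolvent A \<mu> y"
  shows "\<mu> * ((dist z x)\<^sup>2 + (dist z w)\<^sup>2 - (dist x w)\<^sup>2)
    + \<kappa> * ((dist w y)\<^sup>2 + (dist z w)\<^sup>2 - (dist y z)\<^sup>2) \<le> 0"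
  unfolding z_def w_def
  by (rule monotone_resolvent_ineq[OF mono assms(1,2) resolvent_mem[OF assms(1)]
        resolvent_mem[OF assms(2)]])

lemma resolvent_zero_ineq:
  assumes pos: "\<kappa> > 0" and u: "u \<in> zeros A"
  shows "(dist (resolvent A \<kappa> x) x)\<^sup>2 + (dist (resolvent A \<kappa> x) u)\<^sup>2 \<le> (dist x u)\<^sup>2"
proof -
  have "tclass u (1 / 1) (geod u u) \<in> A u"
    using u zero_iff_tclass[of 1 u A] by simp
  from monotone_resolvent_ineq[OF mono pos zero_less_one resolvent_mem[OF pos, of x] this]
  show ?thesis
    by (simp add: dist_commute)
qed

lemma resolvent_dist_zero_le:
  assumes "\<kappa> > 0" "u \<in> zeros A"
  shows "dist (resolvent A \<kappa> x) u \<le> dist x u" "dist (resolvent A \<kappa> x) x \<le> dist x u"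
proof -
  have *: "(dist (resolvent A \<kappa> x) x)\<^sup>2 + (dist (resolvent A \<kappa> x) u)\<^sup>2 \<le> (dist x u)\<^sup>2"
    by (rule resolvent_zero_ineq[OF assms])
  have **: "(dist (resolvent A \<kappa> x) u)\<^sup>2 \<le> (dist x u)\<^sup>2"
    "(dist (resolvent A \<kappa> x) x)\<^sup>2 \<le> (dist x u)\<^sup>2"
    using * zero_le_power2[of "dist (resolvent A \<kappa> x) x"]
      zero_le_power2[of "dist (resolvent A \<kappa> x) u"] by linarith+
  show "dist (resolvent A \<kappa> x) u \<le> dist x u" "dist (resolvent A \<kappa> x) x \<le> dist x u"
    by (rule **[THEN power2_le_imp_le], simp)+
qed

text \<open>Since the left-hand side is nonnegative, \<open>dist (J\<^sub>\<kappa> v) v\<close> increases with \<open>\<kappa>\<close>; and if it is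
  bounded, then \<open>J\<^sub>\<kappa> v\<close> is Cauchy as \<open>\<kappa> \<rightarrow> \<infinity>\<close>.\<close>

lemma resolvent_parameter_ineq:
  assumes pos: "\<mu> > 0" and le: "\<mu> \<le> \<kappa>"
  shows "(dist (resolvent A \<kappa> v) (resolvent A \<mu> v))\<^sup>2
    \<le> (dist (resolvent A \<kappa> v) v)\<^sup>2 - (dist (resolvent A \<mu> v) v)\<^sup>2"
proof -
  define z w where "z = resolvent A \<kappa> v" and "w = resolvent A \<mu> v"
  define D where "D = (dist z v)\<^sup>2 - (dist w v)\<^sup>2"
  have \<kappa>: "\<kappa> > 0"
    using assms by simp
  have main: "(\<kappa> + \<mu>) * (dist z w)\<^sup>2 \<le> (\<kappa> - \<mu>) * D"
    using resolvent_ineq[OF \<kappa> pos, of v v]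
    by (simp add: z_def[symmetric] w_def[symmetric] D_def dist_commute algebra_simps)
  have "0 \<le> (\<kappa> + \<mu>) * (dist z w)\<^sup>2"
    using pos \<kappa> by simp
  with main have "0 \<le> (\<kappa> - \<mu>) * D"
    by linarith
  show ?thesis
  proof (cases "\<kappa> = \<mu>")
    case True
    with main pos show ?thesis
      by (simp add: mult_le_0_iff z_def w_def)
  next
    case False
    with le \<open>0 \<le> (\<kappa> - \<mu>) * D\<close> have "D \<ge> 0"
      by (simp add: zero_le_mult_iff)
    with pos \<kappa> have "(\<kappa> - \<mu>) * D \<le> (\<kappa> + \<mu>) * D"
      by (intro mult_right_mono) auto
    with main have "(\<kappa> + \<mu>) * (dist z w)\<^sup>2 \<le> (\<kappa> + \<mu>) * D"
      by linarith
    with pos \<kappa> show ?thesis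
      by (simp add: D_def z_def w_def)
  qed
qed

text \<open>The points \<open>J\<^bsub>l\<^sub>n\<^esub> x\<^sub>n\<close> are asymptotically at least as far from \<open>v\<close> as every resolvent value
  \<open>J\<^sub>\<mu> v\<close>: divided by \<open>l\<^sub>n\<close>, the term of the resolvent inequality that contains \<open>x\<^sub>n\<close>
  vanishes in the limit.\<close>

lemma resolvent_dist_eventually_le:
  assumes bdd: "bounded (x ` {1..})" and l: "\<And>n. n \<ge> (1::nat) \<Longrightarrow> l n > 0"
    and lim: "filterlim l at_top sequentially" and pos: "\<mu> > 0" "e > 0"
  shows "\<forall>\<^sub>F n in sequentially.
    (dist (resolvent A \<mu> v) v)\<^sup>2 \<le> (dist v (resolvent A (l n) (x n)))\<^sup>2 + e"
proof -
  define w where "w = resolvent A \<mu> v"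
  obtain K where K: "\<And>n. n \<ge> 1 \<Longrightarrow> dist w (x n) \<le> K"
    using bdd bounded_any_center[of "x ` {1..}" w] by auto
  have "\<forall>\<^sub>F n in sequentially. \<mu> * K\<^sup>2 / e \<le> l n"
    using lim by (auto simp: filterlim_at_top)
  then show ?thesis
    using eventually_ge_at_top[of 1]
  proof eventually_elim
    case (elim n)
    define z where "z = resolvent A (l n) (x n)"
    have ln: "l n > 0"
      using l elim by simp
    have "(dist (x n) w)\<^sup>2 \<le> K\<^sup>2"
      using K[OF elim(2)] by (simp add: dist_commute power_mono)
    then have "\<mu> * (dist (x n) w)\<^sup>2 \<le> \<mu> * K\<^sup>2"
      using pos by simp
    also have "\<mu> * K\<^sup>2 \<le> l n * e"
      using elim pos by (simp add: field_simps)
    finally have K: "\<mu> * (dist (x n) w)\<^sup>2 \<le> l n * e" .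
    have "\<mu> * ((dist z (x n))\<^sup>2 + (dist z w)\<^sup>2 - (dist (x n) w)\<^sup>2)
        + l n * ((dist w v)\<^sup>2 + (dist z w)\<^sup>2 - (dist v z)\<^sup>2) \<le> 0"
      unfolding z_def w_def by (rule resolvent_ineq[OF ln pos(1)])
    moreover have "0 \<le> \<mu> * ((dist z (x n))\<^sup>2 + (dist z w)\<^sup>2)" "0 \<le> l n * (dist z w)\<^sup>2"
      using pos ln by auto
    ultimately have "l n * ((dist w v)\<^sup>2 - (dist v z)\<^sup>2) \<le> \<mu> * (dist (x n) w)\<^sup>2"
      by (simp add: algebra_simps)
    with K have "l n * ((dist w v)\<^sup>2 - (dist v z)\<^sup>2) \<le> l n * e"
      by linarith
    with ln show ?case
      by (simp add: z_def w_def)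
  qed
qed

end

text \<open>Boundedness of the curve \<open>\<kappa> \<mapsto> J\<^sub>\<kappa> v\<close> alone yields a zero, namely its limit, which is moreover
  the zero nearest to \<open>v\<close>.  The sharpened minimality \<open>proj\<close> in the proof gives the uniqueness of the
  nearest zero, so that closedness and convexity of \<open>zeros A\<close> are not needed.\<close>

lemma resolvent_tendsto_proj:
  fixes A :: "'a::hadamard_space \<Rightarrow> 'a tvec set"
  assumes mono: "monotone_vector_field A" and surj: "surjectivity_condition A"
    and bdd: "\<And>\<kappa>. \<kappa> > 0 \<Longrightarrow> (dist (resolvent A \<kappa> v) v)\<^sup>2 \<le> M"
  shows "metric_proj (zeros A) v \<in> zeros A"
    and "(\<lambda>k. resolvent A (real (Suc k)) v) \<longlonglongrightarrow> metric_proj (zeros A) v"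
proof -
  define z where "z k = resolvent A (real (Suc k)) v" for k
  define r where "r k = (dist (z k) v)\<^sup>2" for k
  have zz: "(dist (z m) (z n))\<^sup>2 \<le> r m - r n" if "n \<le> m" for m n
    using resolvent_parameter_ineq[OF mono surj, of "real (Suc n)" "real (Suc m)" v] that
    by (simp add: z_def r_def)
  have "incseq r"
    using order_trans[OF zero_le_power2 zz] by (simp add: incseq_def)
  moreover have "r k \<le> M" for k
    using bdd[of "real (Suc k)"] by (simp add: z_def r_def)
  ultimately obtain L where "r \<longlonglongrightarrow> L"
    using incseq_convergent[of r M] by blast
  then have "Cauchy r"
    by (rule LIMSEQ_imp_Cauchy)
  have "Cauchy z"
  proof (rule CauchyI')
    fix e :: real assume "e > 0"
    then obtain N where N: "\<And>m n. m \<ge> N \<Longrightarrow> n \<ge> N \<Longrightarrow> dist (r m) (r n) < e\<^sup>2"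
      using metric_CauchyD[OF \<open>Cauchy r\<close>, of "e\<^sup>2"] by auto
    have "dist (z m) (z n) < e" if "m \<ge> N" "n > m" for m n
    proof -
      have "(dist (z m) (z n))\<^sup>2 < e\<^sup>2"
        using N[of n m] zz[of m n] that by (simp add: dist_real_def dist_commute abs_less_iff)
      then show ?thesis
        using \<open>e > 0\<close> by (simp add: power_less_imp_less_base)
    qed
    then show "\<exists>N. \<forall>m\<ge>N. \<forall>n>m. dist (z m) (z n) < e"
      by blast
  qed
  then obtain p where p: "z \<longlonglongrightarrow> p"
    using Cauchy_convergent convergent_def by blast
  have p_zero: "p \<in> zeros A"
  proof (rule resolvent_fixed_imp_zero[OF mono surj zero_less_one])
    define w where "w = resolvent A 1 p"
    define D where "D k = (dist w p)\<^sup>2 + (dist (z k) w)\<^sup>2 - (dist p (z k))\<^sup>2" for k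
    have D_le: "D k \<le> (dist v w)\<^sup>2 / real (Suc k)" for k
    proof -
      define c where "c = real (Suc k)"
      have "1 * ((dist (z k) v)\<^sup>2 + (dist (z k) w)\<^sup>2 - (dist v w)\<^sup>2) + c * D k \<le> 0"
        unfolding z_def w_def D_def c_def by (rule resolvent_ineq[OF mono surj]) auto
      then have "c * D k \<le> (dist v w)\<^sup>2"
        using zero_le_power2[of "dist (z k) v"] zero_le_power2[of "dist (z k) w"]
        unfolding mult_1 by linarith
      moreover have "c > 0"
        by (simp add: c_def)
      ultimately show ?thesis
        by (simp only: pos_le_divide_eq mult.commute[of _ c] c_def[symmetric])
    qed
    have "D \<longlonglongrightarrow> (dist w p)\<^sup>2 + (dist p w)\<^sup>2 - (dist p p)\<^sup>2"
      unfolding D_def by (intro tendsto_intros p)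
    moreover have "(\<lambda>k. (dist v w)\<^sup>2 / real (Suc k)) \<longlonglongrightarrow> 0"
      by (rule LIMSEQ_Suc[OF lim_const_over_n])
    ultimately have "(dist w p)\<^sup>2 + (dist p w)\<^sup>2 - (dist p p)\<^sup>2 \<le> 0"
      by (rule LIMSEQ_le) (use D_le in blast)
    then have "(dist w p)\<^sup>2 \<le> 0"
      by (simp add: dist_commute[of p w])
    then show "resolvent A 1 p = p"
      by (simp add: w_def)
  qed
  have proj: "(dist p v)\<^sup>2 + (dist p u)\<^sup>2 \<le> (dist v u)\<^sup>2" if u: "u \<in> zeros A" for u
  proof (rule LIMSEQ_le_const2)
    show "(\<lambda>k. (dist (z k) v)\<^sup>2 + (dist (z k) u)\<^sup>2) \<longlonglongrightarrow> (dist p v)\<^sup>2 + (dist p u)\<^sup>2"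
      by (intro tendsto_intros p)
    show "\<exists>N. \<forall>k\<ge>N. (dist (z k) v)\<^sup>2 + (dist (z k) u)\<^sup>2 \<le> (dist v u)\<^sup>2"
      using resolvent_zero_ineq[OF mono surj _ u] by (auto simp: z_def)
  qed
  have "metric_proj (zeros A) v = p"
    unfolding metric_proj_def
  proof (rule the_equality)
    show "p \<in> zeros A \<and> (\<forall>u\<in>zeros A. dist p v \<le> dist u v)"
    proof (intro conjI ballI p_zero)
      fix u assume "u \<in> zeros A"
      then have "(dist p v)\<^sup>2 \<le> (dist u v)\<^sup>2"
        using proj[of u] zero_le_power2[of "dist p u"] unfolding dist_commute[of v u] by linarith
      then show "dist p v \<le> dist u v"
        by (rule power2_le_imp_le) simp
    qed
    fix y assume y: "y \<in> zeros A \<and> (\<forall>u\<in>zeros A. dist y v \<le> dist u v)"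
    then have "(dist y v)\<^sup>2 \<le> (dist p v)\<^sup>2"
      using p_zero by (intro power_mono) auto
    moreover have "(dist p v)\<^sup>2 + (dist p y)\<^sup>2 \<le> (dist y v)\<^sup>2"
      using proj[of y] y by (simp add: dist_commute[of v y])
    ultimately have "(dist p y)\<^sup>2 \<le> 0"
      by linarith
    then show "y = p"
      by simp
  qed
  then show "metric_proj (zeros A) v \<in> zeros A"
    and "(\<lambda>k. resolvent A (real (Suc k)) v) \<longlonglongrightarrow> metric_proj (zeros A) v"
    using p p_zero by (simp_all add: z_def[abs_def] del: of_nat_Suc)
qed

section \<open>Convergence of the iteration\<close>

text \<open>Once \<open>t n \<le> d\<close>, the excess \<open>s n - d\<close> is multiplied by at most \<open>1 - a n \<le> exp (- a n)\<close> in each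
  step, and the product of these factors tends to \<open>0\<close> because \<open>a\<close> is not summable.\<close>

lemma Xu_recursion_tendsto_0:
  fixes s a t :: "nat \<Rightarrow> real"
  assumes nonneg: "\<And>n. s n \<ge> 0" and a: "\<And>n. n \<ge> 1 \<Longrightarrow> a n \<in> {0..1}"
    and rec: "\<And>n. n \<ge> 1 \<Longrightarrow> s (Suc n) \<le> (1 - a n) * s n + a n * t n"
    and t: "\<And>e. e > 0 \<Longrightarrow> \<forall>\<^sub>F n in sequentially. t n \<le> e"
    and sum: "filterlim (\<lambda>N. \<Sum>n=1..N. a n) at_top sequentially"
  shows "s \<longlonglongrightarrow> 0"
proof (rule LIMSEQ_I)
  fix e :: real assume "e > 0"
  define d where "d = e / 2"
  have d: "d > 0"
    using \<open>e > 0\<close> by (simp add: d_def)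
  define S where "S N = (\<Sum>n=1..N. a n)" for N
  obtain N0 where N0: "\<And>n. n \<ge> N0 \<Longrightarrow> t n \<le> d"
    using t[OF d] by (auto simp: eventually_sequentially)
  define N where "N = max N0 1"
  define K where "K = \<bar>s (Suc N) - d\<bar>"
  have decay: "s (Suc n) - d \<le> exp (S N - S n) * K" if "n \<ge> N" for n
    using that
  proof (induction n rule: dec_induct)
    case base
    then show ?case
      by (simp add: K_def)
  next
    case (step n)
    have n: "Suc n \<ge> 1" "Suc n \<ge> N0"
      using step by (auto simp: N_def)
    have "a (Suc n) * t (Suc n) \<le> a (Suc n) * d"
      using a[OF n(1)] N0[OF n(2)] by (intro mult_left_mono) auto
    with rec[OF n(1)] have "s (Suc (Suc n)) - d \<le> (1 - a (Suc n)) * (s (Suc n) - d)"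
      by (simp add: algebra_simps)
    also have "\<dots> \<le> (1 - a (Suc n)) * (exp (S N - S n) * K)"
      using a[OF n(1)] step.IH by (intro mult_left_mono) auto
    also have "\<dots> \<le> exp (- a (Suc n)) * (exp (S N - S n) * K)"
      using exp_ge_add_one_self[of "- a (Suc n)"] by (intro mult_right_mono) (auto simp: K_def)
    also have "\<dots> = exp (S N - S (Suc n)) * K"
      by (simp add: S_def mult.assoc[symmetric] exp_add[symmetric] algebra_simps)
    finally show ?case .
  qed
  have "filterlim (\<lambda>n. S N - S n) at_bot sequentially"
    using sum unfolding filterlim_at_top filterlim_at_bot S_def
  proof (intro allI)
    fix Z
    assume "\<forall>Z. \<forall>\<^sub>F x in sequentially. Z \<le> (\<Sum>n = 1..x. a n)"
    then have "\<forall>\<^sub>F x in sequentially. (\<Sum>n = 1..N. a n) - Z \<le> (\<Sum>n = 1..x. a n)"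
      by blast
    then show "\<forall>\<^sub>F x in sequentially. (\<Sum>n = 1..N. a n) - (\<Sum>n = 1..x. a n) \<le> Z"
      by eventually_elim simp
  qed
  then have "(\<lambda>n. exp (S N - S n) * K) \<longlonglongrightarrow> 0"
    by (intro tendsto_mult_left_zero filterlim_compose[OF exp_at_bot])
  then have "\<forall>\<^sub>F n in sequentially. exp (S N - S n) * K < d"
    using d by (rule order_tendstoD)
  then have "\<forall>\<^sub>F n in sequentially. s (Suc n) < e"
    using eventually_ge_at_top[of N]
  proof eventually_elim
    case (elim n)
    then show ?case
      using decay[OF elim(2)] by (simp add: d_def field_simps)
  qed
  then have "\<forall>\<^sub>F n in sequentially. s n < e"
    using eventually_sequentially_Suc[of "\<lambda>n. s n < e"] by blast
  then show "\<exists>no. \<forall>n\<ge>no. norm (s n - 0) < e"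
    using nonneg by (auto simp: eventually_sequentially)
qed

lemma dist_geod_comb_le:
  fixes v y z :: "'a::cat0_space"
  assumes t: "t \<in> {0..1}" and "dist v z \<le> R" "dist y z \<le> R"
  shows "dist (geod_comb t v y) z \<le> R"
proof (rule power2_le_imp_le)
  have "(1 - t) * (dist v z)\<^sup>2 + t * (dist y z)\<^sup>2 \<le> (1 - t) * R\<^sup>2 + t * R\<^sup>2"
    using assms by (intro add_mono mult_left_mono power_mono) auto
  moreover have "0 \<le> t * (1 - t) * (dist v y)\<^sup>2"
    using t by simp
  ultimately show "(dist (geod_comb t v y) z)\<^sup>2 \<le> R\<^sup>2"
    using dist_geod_comb_sq_le[OF t, of v y z] by (simp add: algebra_simps)
  show "0 \<le> R"
    using assms(2) zero_le_dist[of v z] by linarith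
qed

text \<open>The iteration \<open>x\<^sub>n\<^sub>+\<^sub>1 = a\<^sub>n v \<oplus> (1 - a\<^sub>n) J\<^bsub>l\<^sub>n\<^esub> x\<^sub>n\<close>, started at index \<open>1\<close>, for a
  monotone vector field with everywhere defined resolvents and parameters \<open>l\<^sub>n \<rightarrow> \<infinity>\<close>.\<close>

locale halpern_iteration =
  fixes A :: "'a::hadamard_space \<Rightarrow> 'a tvec set"
    and v :: 'a
    and x :: "nat \<Rightarrow> 'a"
    and a l :: "nat \<Rightarrow> real"
  assumes mono: "monotone_vector_field A"
    and surj: "surjectivity_condition A"
    and a: "\<And>n. n \<ge> 1 \<Longrightarrow> a n \<in> {0..1}"
    and l: "\<And>n. n \<ge> 1 \<Longrightarrow> l n > 0"
    and l_lim: "filterlim l at_top sequentially"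
    and step: "\<And>n. n \<ge> 1 \<Longrightarrow> x (n + 1) = geod_comb (1 - a n) v (resolvent A (l n) (x n))"
begin

text \<open>The resolvent values \<open>J\<^bsub>l\<^sub>n\<^esub> x\<^sub>n\<close>.\<close>

definition y :: "nat \<Rightarrow> 'a" where
  "y n = resolvent A (l n) (x n)"

lemma x_Suc: "n \<ge> 1 \<Longrightarrow> x (Suc n) = geod_comb (1 - a n) v (y n)"
  using step by (simp add: y_def)

lemma bounded_x:
  assumes "bounded (y ` {1..})"
  shows "bounded (x ` {1..})"
proof -
  obtain K where K: "\<And>n. n \<ge> 1 \<Longrightarrow> dist v (y n) \<le> K"
    using assms bounded_any_center[of "y ` {1..}" v] by auto
  have "dist v (x n) \<le> max (dist v (x 1)) K" if "n \<ge> 1" for n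
    using that
  proof (induction n rule: dec_induct)
    case (step n)
    have "dist v (y n) \<ge> 0"
      by simp
    with K[OF step(1)] have "0 \<le> K" "dist (y n) v \<le> K"
      unfolding dist_commute[of "y n" v] by linarith+
    then have "dist (x (Suc n)) v \<le> K"
      using x_Suc[of n] a[of n] step(1) by (simp add: dist_geod_comb_le)
    then show ?case
      by (simp add: dist_commute)
  qed simp
  then show ?thesis
    unfolding bounded_def by blast
qed

lemma bounded_y:
  assumes u: "u \<in> zeros A"
  shows "bounded (y ` {1..})"
proof -
  define R where "R = max (dist (x 1) u) (dist v u)"
  have y_le: "dist (y n) u \<le> dist (x n) u" if "n \<ge> 1" for n
    using resolvent_dist_zero_le(1)[OF mono surj l[OF that] u] by (simp add: y_def)
  have x_le: "dist (x n) u \<le> R" if "n \<ge> 1" for n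
    using that
  proof (induction n rule: dec_induct)
    case (step n)
    then have "dist (y n) u \<le> R"
      using y_le[of n] by simp
    then show ?case
      using x_Suc[of n] a[of n] step(1) by (simp add: dist_geod_comb_le R_def)
  qed (simp add: R_def)
  have "dist u (y n) \<le> R" if "n \<ge> 1" for n
    using y_le[OF that] x_le[OF that] by (simp add: dist_commute)
  then show ?thesis
    unfolding bounded_def by blast
qed

lemma zeros_nonempty:
  assumes bdd: "bounded (y ` {1..})"
  shows "zeros A \<noteq> {}"
proof -
  obtain K where K: "\<And>n. n \<ge> 1 \<Longrightarrow> dist v (y n) \<le> K"
    using bdd bounded_any_center[of "y ` {1..}" v] by auto
  have "(dist (resolvent A \<kappa> v) v)\<^sup>2 \<le> K\<^sup>2 + 1" if "\<kappa> > 0" for \<kappa>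
  proof -
    have "\<forall>\<^sub>F n in sequentially. (dist (resolvent A \<kappa> v) v)\<^sup>2 \<le> (dist v (y n))\<^sup>2 + 1 \<and> n \<ge> 1"
      using resolvent_dist_eventually_le[OF mono surj bounded_x[OF bdd] l l_lim that zero_less_one]
      by (intro eventually_conj eventually_ge_at_top) (simp add: y_def)
    then obtain n where n: "(dist (resolvent A \<kappa> v) v)\<^sup>2 \<le> (dist v (y n))\<^sup>2 + 1" "n \<ge> 1"
      by (auto simp: eventually_sequentially)
    moreover have "(dist v (y n))\<^sup>2 \<le> K\<^sup>2"
      using K[OF n(2)] by (intro power_mono) auto
    ultimately show ?thesis
      by linarith
  qed
  from resolvent_tendsto_proj(1)[OF mono surj this] show ?thesis
    by blast
qed

lemma tendsto_proj:
  assumes u: "u \<in> zeros A" and a_lim: "a \<longlonglongrightarrow> 0"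
    and a_sum: "filterlim (\<lambda>N. \<Sum>n=1..N. a n) at_top sequentially"
  defines "p \<equiv> metric_proj (zeros A) v"
  shows "x \<longlonglongrightarrow> p" "y \<longlonglongrightarrow> p"
proof -
  have res_bdd: "(dist (resolvent A \<kappa> v) v)\<^sup>2 \<le> (dist v u)\<^sup>2" if "\<kappa> > 0" for \<kappa>
    using resolvent_dist_zero_le(2)[OF mono surj that u, of v] by (simp add: power_mono)
  note p = resolvent_tendsto_proj[OF mono surj res_bdd, folded p_def]
  have y_bdd: "bounded (y ` {1..})"
    by (rule bounded_y[OF u])
  have y_le: "dist (y n) p \<le> dist (x n) p" if "n \<ge> 1" for n
    using resolvent_dist_zero_le(1)[OF mono surj l[OF that] p(1)] by (simp add: y_def)
  \<comment> \<open>The recursion to which the divergence of the sum of \<open>a\<close> is applied.\<close>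
  define s where "s n = (dist (x n) p)\<^sup>2" for n
  define t where "t n = (dist v p)\<^sup>2 - (1 - a n) * (dist v (y n))\<^sup>2" for n
  have rec: "s (Suc n) \<le> (1 - a n) * s n + a n * t n" if n: "n \<ge> 1" for n
  proof -
    have "s (Suc n) \<le> a n * (dist v p)\<^sup>2 + (1 - a n) * (dist (y n) p)\<^sup>2
        - (1 - a n) * a n * (dist v (y n))\<^sup>2"
      using dist_geod_comb_sq_le[of "1 - a n" v "y n" p] a[OF n] n by (simp add: s_def x_Suc)
    moreover have "(1 - a n) * (dist (y n) p)\<^sup>2 \<le> (1 - a n) * s n"
      unfolding s_def using a[OF n] y_le[OF n] by (intro mult_left_mono power_mono) auto
    ultimately show ?thesis
      by (simp add: t_def algebra_simps)
  qed
  have t_le: "\<forall>\<^sub>F n in sequentially. t n \<le> e" if "e > 0" for e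
  proof -
    define d where "d = e / 4"
    have d: "d > 0"
      using that by (simp add: d_def)
    obtain K where K: "\<And>n. n \<ge> 1 \<Longrightarrow> dist v (y n) \<le> K"
      using y_bdd bounded_any_center[of "y ` {1..}" v] by auto
    \<comment> \<open>Some resolvent value of \<open>v\<close> is almost as far from \<open>v\<close> as \<open>p\<close> is, and eventually
      \<open>y n\<close> is almost as far as that one.\<close>
    have "(\<lambda>k. (dist (resolvent A (real (Suc k)) v) v)\<^sup>2) \<longlonglongrightarrow> (dist p v)\<^sup>2"
      by (intro tendsto_intros p(2))
    then have "\<forall>\<^sub>F k in sequentially.
        (dist p v)\<^sup>2 - d < (dist (resolvent A (real (Suc k)) v) v)\<^sup>2"
      by (rule order_tendstoD) (use d in simp)
    then obtain k where k: "(dist v p)\<^sup>2 - d < (dist (resolvent A (real (Suc k)) v) v)\<^sup>2"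
      by (auto simp: eventually_sequentially dist_commute)
    have "(\<lambda>n. a n * K\<^sup>2) \<longlonglongrightarrow> 0"
      by (intro tendsto_mult_left_zero a_lim)
    then have "\<forall>\<^sub>F n in sequentially. a n * K\<^sup>2 < d"
      using d by (rule order_tendstoD)
    moreover have "\<forall>\<^sub>F n in sequentially.
        (dist (resolvent A (real (Suc k)) v) v)\<^sup>2 \<le> (dist v (y n))\<^sup>2 + d"
      unfolding y_def
      by (rule resolvent_dist_eventually_le[OF mono surj bounded_x[OF y_bdd] l l_lim _ d]) auto
    ultimately show ?thesis
      using eventually_ge_at_top[of 1]
    proof eventually_elim
      case (elim n)
      have "a n * (dist v (y n))\<^sup>2 \<le> a n * K\<^sup>2"
        using a[OF elim(3)] K[OF elim(3)] by (intro mult_left_mono power_mono) auto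
      then have "t n \<le> (dist v p)\<^sup>2 - (dist v (y n))\<^sup>2 + a n * K\<^sup>2"
        by (simp add: t_def algebra_simps)
      then show ?case
        using elim k that unfolding d_def by linarith
    qed
  qed
  have "s \<longlonglongrightarrow> 0"
    by (rule Xu_recursion_tendsto_0[OF _ a rec t_le a_sum]) (auto simp: s_def)
  then have "(\<lambda>n. sqrt (s n)) \<longlonglongrightarrow> sqrt 0"
    by (rule tendsto_real_sqrt)
  then have x_lim: "(\<lambda>n. dist (x n) p) \<longlonglongrightarrow> 0"
    by (simp add: s_def)
  then show "x \<longlonglongrightarrow> p"
    by (rule iffD2[OF tendsto_dist_iff])
  have "(\<lambda>n. dist (y n) p) \<longlonglongrightarrow> 0"
  proof (rule tendsto_sandwich[OF _ _ tendsto_const x_lim])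
    show "\<forall>\<^sub>F n in sequentially. dist (y n) p \<le> dist (x n) p"
      using eventually_ge_at_top[of 1] by eventually_elim (rule y_le)
  qed simp
  then show "y \<longlonglongrightarrow> p"
    by (rule iffD2[OF tendsto_dist_iff])
qed

end

theorem theorem6p3:
  fixes A :: "'a::hadamard_space \<Rightarrow> 'a tvec set"
    and v :: 'a
    and x :: "nat \<Rightarrow> 'a"
    and a l :: "nat \<Rightarrow> real"
  assumes "monotone_vector_field A"
    and "surjectivity_condition A"
    and "\<And>n. n \<ge> 1 \<Longrightarrow> a n \<in> {0..1}"
    and "\<And>n. n \<ge> 1 \<Longrightarrow> l n > 0"
    and "filterlim l at_top sequentially"
    and "\<And>n. n \<ge> 1 \<Longrightarrow> x (n + 1) = geod_comb (1 - a n) v (resolvent A (l n) (x n))"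
  shows "(bounded ((\<lambda>n. resolvent A (l n) (x n)) ` {1..}) \<longleftrightarrow> zeros A \<noteq> {}) \<and>
    (zeros A \<noteq> {} \<longrightarrow> a \<longlonglongrightarrow> 0 \<longrightarrow>
       filterlim (\<lambda>N. \<Sum>n=1..N. a n) at_top sequentially \<longrightarrow>
       x \<longlonglongrightarrow> metric_proj (zeros A) v \<and>
       (\<lambda>n. resolvent A (l n) (x n)) \<longlonglongrightarrow> metric_proj (zeros A) v)"
proof -
  interpret halpern_iteration A v x a l
    using assms by unfold_locales
  have y: "(\<lambda>n. resolvent A (l n) (x n)) = y"
    by (rule ext) (rule y_def[symmetric])
  show ?thesis
    unfolding y using bounded_y zeros_nonempty tendsto_proj by blast
qed

end
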